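(* Let $K$ be a convex body in $\mathbb{E}^d$, $d \geq 3$, and let $\{z_{\beta}\}_{\beta \in \mathcal{B}} \subset \mathbb{E}^d \setminus K$ be a set of exterior points of $K$ such that: (i) for every supporting line $l$ of $K$ there exists $\beta \in \mathcal{B}$ with $z_{\beta} \in l$; (ii) for a fixed integer $k$ with $3 \leq k \leq d$, and for all $\beta \in \mathcal{B}$, every $k$-dimensional visual cone $C_k(z_{\beta}, K)$ is polyhedral. Then $K$ is a polytope.
   Context: A convex body is a compact convex subset of $\mathbb{E}^d$ with non-empty interior. A line $l$ is a supporting line of $K$ if $l \cap K \neq \emptyset$ and $l \cap K \subset \partial K$. A polytope is the convex hull of finitely many points. For a set $V \subset \mathbb{E}^d$ and a point $z \notin V$, the (full-dimensional) visual cone of $V$ with apex $z$ is $C(z,V) = \{ z + t(x - z) : x \in V,\ t \geq 0\}$. For $2 \le k \le d$ and a $k$-dimensional affine subspace $H$ with $z \in H$ and $H \cap \operatorname{int} V \neq \emptyset$, the $k$-dimensional visual cone is $C_k(z,V) = C(z,V) \cap H$ (for $k=d$, $H=\mathbb{E}^d$ and $C_d(z,V)=C(z,V)$); "every $k$-dimensional visual cone" means this for every such $H$. A cone with apex $z$ in a $k$-dimensional affine space $H$ is polyhedral if it is a non-empty intersection of finitely many closed half-spaces of $H$ (a translate of a polyhedral cone with apex at the origin). *)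

theory Defs
  imports "HOL-Analysis.Analysis"
begin

definition convex_body :: "'a::euclidean_space set \<Rightarrow> bool" where
  "convex_body K \<longleftrightarrow> compact K \<and> convex K \<and> interior K \<noteq> {}"

definition is_line :: "'a::euclidean_space set \<Rightarrow> bool" where
  "is_line l \<longleftrightarrow> affine l \<and> aff_dim l = 1"

definition supporting_line :: "'a::euclidean_space set \<Rightarrow> 'a set \<Rightarrow> bool" where
  "supporting_line K l \<longleftrightarrow> is_line l \<and> l \<inter> K \<noteq> {} \<and> l \<inter> K \<subseteq> frontier K"

definition visual_cone :: "'a::euclidean_space \<Rightarrow> 'a set \<Rightarrow> 'a set" where
  "visual_cone z V = {z + t *\<^sub>R (x - z) | x t. x \<in> V \<and> t \<ge> 0}"

definition polyhedral_in :: "'a::euclidean_space set \<Rightarrow> 'a set \<Rightarrow> bool" where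
  "polyhedral_in H C \<longleftrightarrow> C \<noteq> {} \<and>
     (\<exists>F. finite F \<and> (\<forall>h\<in>F. \<exists>a b. a \<noteq> 0 \<and> h = {x. a \<bullet> x \<le> b}) \<and> C = H \<inter> \<Inter>F)"

end

theory Submission
  imports Defs
begin

text \<open>The main tool is a criterion for finite generation: a convex cone \<open>T\<close> is finitely generated as soon as
  \<open>T + \<real>u\<close> is closed for every \<open>u \<in> T\<close>. It is applied twice.

  First, the cone \<open>T\<close> spanned by \<open>K - z\<close> satisfies the criterion whenever the \<open>k\<close>-dimensional visual cones from
  \<open>z\<close> are polyhedral: closedness of \<open>T + \<real>u\<close> at a point \<open>y\<close> can be tested in a subspace containing \<open>u\<close>, \<open>y\<close>
  and an interior point of \<open>T\<close>, and here \<open>k \<ge> 3\<close> is what is needed.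

  Second, the epigraph \<open>E\<close> of the support function of \<open>K\<close> satisfies the criterion. For a point \<open>(v, r)\<close> in the
  closure of \<open>E + \<real>(a, s)\<close> but not in it, a supporting functional produces \<open>p \<in> K\<close> with \<open>a \<bullet> p = s\<close> and
  \<open>v \<bullet> p = r\<close>. A line through \<open>p\<close> orthogonal to \<open>a\<close> and \<open>v\<close> supports \<open>K\<close>, so it contains some \<open>z\<^sub>\<beta>\<close>, and the
  finitely many generators of the cone of \<open>K - z\<^sub>\<beta>\<close> yield \<open>(v, r) + c(a, s) \<in> E\<close> for some \<open>c\<close>, a
  contradiction. Finitely many generators of \<open>E\<close> are finitely many half-spaces cutting out \<open>K\<close>.\<close>

section \<open>Subspaces and finite systems of linear inequalities\<close>

lemma subspace_superset_of_dim:
  fixes W :: "'a::euclidean_space set"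
  assumes "dim W \<le> k" "k \<le> DIM('a)"
  obtains S where "subspace S" "W \<subseteq> S" "dim S = k"
proof -
  have "\<exists>S. subspace S \<and> W \<subseteq> S \<and> dim S = k"
    using assms
  proof (induction k rule: dec_induct)
    case base
    show ?case
      by (intro exI[of _ "span W"]) (simp add: span_superset)
  next
    case (step n)
    then obtain S where S: "subspace S" "W \<subseteq> S" "dim S = n"
      by auto
    with step.prems have "S \<noteq> UNIV"
      by auto
    then obtain x where "x \<notin> span S"
      using S(1) by (metis UNIV_eq_I span_eq_iff)
    then have "dim (span (insert x S)) = Suc n"
      using S(3) by (simp add: dim_insert)
    moreover have "W \<subseteq> span (insert x S)"
      using S(2) span_superset by blast
    ultimately show ?case
      using subspace_span by blast
  qed
  with that show thesis
    by blast
qed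

text \<open>An inequality with \<open>a \<bullet> u < 0\<close> holds for all large
  \<open>c\<close>, and one with \<open>a \<bullet> u = 0\<close> does not depend on
  \<open>c\<close>; since \<open>A\<close> is finite, a single large \<open>c\<close> serves all of
  them.\<close>

lemma ray_enters_polyhedral_cone:
  fixes A :: "'a::euclidean_space set"
  assumes "finite A"
    and "\<And>a. a \<in> A \<Longrightarrow> a \<bullet> u \<le> 0"
    and "\<And>a. a \<in> A \<Longrightarrow> a \<bullet> u = 0 \<Longrightarrow> a \<bullet> y \<le> 0"
  obtains c where "\<And>a. a \<in> A \<Longrightarrow> a \<bullet> (y + c *\<^sub>R u) \<le> 0"
proof -
  have "eventually (\<lambda>c. a \<bullet> (y + c *\<^sub>R u) \<le> 0) at_top" if "a \<in> A" for a
  proof (cases "a \<bullet> u = 0")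
    case True
    then show ?thesis
      using assms(3)[OF that] by (simp add: inner_add_right)
  next
    case False
    then have neg: "a \<bullet> u < 0"
      using assms(2)[OF that] by simp
    have "a \<bullet> (y + c *\<^sub>R u) \<le> 0" if "c \<ge> (a \<bullet> y) / - (a \<bullet> u)" for c
      using that neg by (simp add: inner_add_right field_simps)
    then show ?thesis
      unfolding eventually_at_top_linorder by blast
  qed
  then have "eventually (\<lambda>c. \<forall>a\<in>A. a \<bullet> (y + c *\<^sub>R u) \<le> 0) at_top"
    by (intro eventually_ball_finite assms(1)) auto
  then have "\<exists>c. \<forall>a\<in>A. a \<bullet> (y + c *\<^sub>R u) \<le> 0"
    by (auto simp: eventually_at_top_linorder)
  then show thesis
    using that by blast
qed

section \<open>Finite generation of convex cones\<close>

text \<open>The polytope \<open>convex hull H\<close> is cut out by finitely many half-spaces. Those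
  with \<open>0\<close> on their boundary contain the whole cone, the others contain a ball around
  \<open>0\<close>.\<close>

lemma convex_cone_hull_near_0:
  fixes H :: "'a::euclidean_space set"
  assumes "finite H" "0 \<in> H"
  obtains d where "d > 0" "convex_cone hull H \<inter> ball 0 d \<subseteq> convex hull H"
proof -
  have "polyhedron (convex hull H)"
    by (intro polytope_imp_polyhedron polytope_convex_hull assms(1))
  then obtain F where F: "finite F" "convex hull H = \<Inter>F"
    and half: "\<And>h. h \<in> F \<Longrightarrow> \<exists>a b. a \<noteq> 0 \<and> h = {x. a \<bullet> x \<le> b}"
    unfolding polyhedron_def by metis
  have "\<exists>d>0. convex_cone hull H \<inter> ball 0 d \<subseteq> h" if h: "h \<in> F" for h
  proof -
    obtain a b where ab: "a \<noteq> 0" "h = {x. a \<bullet> x \<le> b}"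
      using half[OF h] by blast
    have Hh: "H \<subseteq> h"
      using F(2) h hull_subset[of H convex] by blast
    with assms(2) have b: "b \<ge> 0"
      using ab by auto
    show ?thesis
    proof (cases "b = 0")
      case True
      have "convex_cone hull H \<subseteq> h"
        by (rule hull_minimal[OF Hh]) (simp add: ab True convex_cone_halfspace_le)
      then show ?thesis
        by (intro exI[of _ 1]) auto
    next
      case False
      with b have "b > 0" by simp
      have "ball 0 (b / norm a) \<subseteq> h"
      proof
        fix x :: 'a assume "x \<in> ball 0 (b / norm a)"
        then have "norm a * norm x \<le> b"
          using ab(1) by (simp add: field_simps)
        then show "x \<in> h"
          using norm_cauchy_schwarz[of a x] ab(2) by simp
      qed
      then show ?thesis
        using ab(1) \<open>b > 0\<close> by (intro exI[of _ "b / norm a"]) auto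
    qed
  qed
  then obtain d where d: "\<And>h. h \<in> F \<Longrightarrow> d h > 0 \<and> convex_cone hull H \<inter> ball 0 (d h) \<subseteq> h"
    by metis
  show thesis
  proof
    \<comment> \<open>The inserted \<open>1\<close> covers the case of an empty
      \<open>F\<close>.\<close>
    show "Min (insert 1 (d ` F)) > 0"
      using F(1) d by simp
    show "convex_cone hull H \<inter> ball 0 (Min (insert 1 (d ` F))) \<subseteq> convex hull H"
      unfolding F(2) using F(1) d by fastforce
  qed
qed

text \<open>Generators of the projection along \<open>u\<close> are lifted back to \<open>T\<close>,
  and \<open>u\<close> is added to them. A point near \<open>u\<close> has a small projection, whose
  lift is off by only a small multiple of \<open>u\<close>; the point's own
  \<open>u\<close>-component, close to \<open>1\<close>, absorbs this error.\<close>

lemma conic_locally_generated: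
  fixes T :: "'a::euclidean_space set"
  assumes cone: "convex_cone T" and u: "u \<in> T" "u \<noteq> 0"
    and fin: "finite H" "0 \<in> H"
    and proj: "convex_cone hull H = {t + s *\<^sub>R u |t s. t \<in> T} \<inter> {x. u \<bullet> x = 0}"
  obtains e G where "e > 0" "finite G" "G \<subseteq> T" "T \<inter> ball u e \<subseteq> convex_cone hull G"
proof -
  have "\<exists>s. h - s *\<^sub>R u \<in> T" if "h \<in> H" for h
  proof -
    have "h \<in> {t + s *\<^sub>R u |t s. t \<in> T}"
      using that proj hull_inc[of h H convex_cone] by blast
    then obtain t r where "h = t + r *\<^sub>R u" "t \<in> T"
      by blast
    then have "h - r *\<^sub>R u \<in> T"
      by simp
    then show ?thesis ..
  qed
  then obtain s where s: "\<And>h. h \<in> H \<Longrightarrow> h - s h *\<^sub>R u \<in> T"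
    by metis
  \<comment> \<open>The inserted \<open>1\<close> makes \<open>M\<close> positive, so that division
    by \<open>2 * M\<close> is safe.\<close>
  define M where "M = Max (insert 1 ((\<lambda>h. \<bar>s h\<bar>) ` H))"
  have M1: "M \<ge> 1" and M: "\<And>h. h \<in> H \<Longrightarrow> \<bar>s h\<bar> \<le> M"
    using fin(1) by (auto simp: M_def)
  define G where "G = insert u ((\<lambda>h. h - s h *\<^sub>R u) ` H)"
  let ?C = "convex_cone hull G"
  have uG: "u \<in> ?C"
    by (simp add: G_def hull_inc)
  \<comment> \<open>Points whose lifting error is at most \<open>M\<close>. Convexity of
    \<open>X\<close> extends this bound from \<open>H\<close> to its convex hull; on the whole cone
    there need be no such bound.\<close>
  define X where "X = {x. \<exists>r. \<bar>r\<bar> \<le> M \<and> x - r *\<^sub>R u \<in> ?C}"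
  have "convex X"
  proof (rule convexI)
    fix x y and p q :: real
    assume "x \<in> X" "y \<in> X" and pq: "p \<ge> 0" "q \<ge> 0" "p + q = 1"
    then obtain r r' where r: "\<bar>r\<bar> \<le> M" "x - r *\<^sub>R u \<in> ?C" "\<bar>r'\<bar> \<le> M" "y - r' *\<^sub>R u \<in> ?C"
      by (auto simp: X_def)
    have "p *\<^sub>R (x - r *\<^sub>R u) + q *\<^sub>R (y - r' *\<^sub>R u) \<in> ?C"
      using r pq by (intro convex_cone_hull_add convex_cone_hull_mul)
    then have "p *\<^sub>R x + q *\<^sub>R y - (p * r + q * r') *\<^sub>R u \<in> ?C"
      by (simp add: algebra_simps)
    moreover have "\<bar>p * r + q * r'\<bar> \<le> M"
    proof -
      have "\<bar>p * r + q * r'\<bar> \<le> p * \<bar>r\<bar> + q * \<bar>r'\<bar>"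
        using pq abs_triangle_ineq[of "p * r" "q * r'"] by (simp add: abs_mult)
      also have "\<dots> \<le> p * M + q * M"
        using r pq by (intro add_mono mult_left_mono)
      finally show ?thesis
        using pq by (simp flip: distrib_right)
    qed
    ultimately show "p *\<^sub>R x + q *\<^sub>R y \<in> X"
      by (auto simp: X_def)
  qed
  moreover have "H \<subseteq> X"
    using M by (auto simp: X_def G_def intro!: hull_inc)
  ultimately have hull_X: "convex hull H \<subseteq> X"
    by (simp add: hull_minimal)
  obtain d where d: "d > 0" "convex_cone hull H \<inter> ball 0 d \<subseteq> convex hull H"
    using convex_cone_hull_near_0[OF fin] by blast
  define c where "c w = (u \<bullet> w) / (u \<bullet> u)" for w
  define p where "p w = w - c w *\<^sub>R u" for w
  have uu: "u \<bullet> u > 0"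
    using u by simp
  have "c u = 1" "p u = 0"
    using uu by (simp_all add: c_def p_def)
  moreover have c_cont: "isCont c u"
    unfolding c_def by (intro continuous_intros) (use uu in auto)
  moreover have "isCont p u"
    unfolding p_def by (intro continuous_intros c_cont)
  ultimately have "(c \<longlongrightarrow> 1) (nhds u)" "(p \<longlongrightarrow> 0) (nhds u)"
    by (metis tendsto_at_iff_tendsto_nhds isCont_def)+
  \<comment> \<open>The thresholds fit together: \<open>2 * M\<close> times \<open>p w\<close> still
    lies in the ball of radius \<open>d\<close>, so the lifting error of \<open>p w\<close> is at
    most \<open>M / (2 * M) = 1/2\<close>, which is below \<open>c w\<close>.\<close>
  then have "eventually (\<lambda>w. c w > 1/2) (nhds u)"
    and "eventually (\<lambda>w. dist (p w) 0 < d / (2 * M)) (nhds u)"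
    using order_tendstoD(1)[of c 1 "nhds u" "1/2"] tendstoD[of p 0 "nhds u" "d / (2 * M)"] d(1) M1
    by (simp_all del: dist_0_norm)
  then have "eventually (\<lambda>w. c w > 1/2 \<and> norm (p w) < d / (2 * M)) (nhds u)"
    by eventually_elim auto
  then obtain e where e: "e > 0"
    and near: "\<And>w. dist w u < e \<Longrightarrow> c w > 1/2 \<and> norm (p w) < d / (2 * M)"
    unfolding eventually_nhds_metric by blast
  have "w \<in> ?C" if w: "w \<in> T" "dist u w < e" for w
  proof -
    have cw: "c w > 1/2" and pw: "norm (p w) < d / (2 * M)"
      using near w(2) by (auto simp: dist_commute)
    have "u \<bullet> p w = 0"
      using uu by (simp add: p_def c_def inner_diff_right)
    moreover have "p w \<in> {t + s *\<^sub>R u |t s. t \<in> T}"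
      using w(1) by (auto simp: p_def intro!: exI[of _ w] exI[of _ "- c w"])
    ultimately have "p w \<in> convex_cone hull H"
      using proj by blast
    then have "(2 * M) *\<^sub>R p w \<in> convex_cone hull H"
      using M1 by (intro convex_cone_hull_mul) auto
    moreover have "(2 * M) *\<^sub>R p w \<in> ball 0 d"
      using pw M1 by (simp add: field_simps)
    ultimately have "(2 * M) *\<^sub>R p w \<in> X"
      using d(2) hull_X by blast
    then obtain r where r: "\<bar>r\<bar> \<le> M" "(2 * M) *\<^sub>R p w - r *\<^sub>R u \<in> ?C"
      by (auto simp: X_def)
    have "(1 / (2 * M)) *\<^sub>R ((2 * M) *\<^sub>R p w - r *\<^sub>R u) \<in> ?C"
      using r(2) M1 by (intro convex_cone_hull_mul) auto
    then have 1: "p w - (r / (2 * M)) *\<^sub>R u \<in> ?C"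
      using M1 by (simp add: scaleR_right_diff_distrib)
    have "- r / (2 * M) \<le> 1/2"
      using r(1) M1 by (simp add: field_simps)
    then have 2: "(c w + r / (2 * M)) *\<^sub>R u \<in> ?C"
      using cw by (intro convex_cone_hull_mul uG) auto
    from convex_cone_hull_add[OF 1 2] show ?thesis
      by (simp add: p_def algebra_simps)
  qed
  then show thesis
    using that[of e G] e fin(1) s u(1) by (auto simp: G_def subset_iff)
qed

lemma convex_cone_plus_line:
  assumes "convex_cone T"
  shows "convex_cone {t + s *\<^sub>R u |t s. t \<in> T}"
  unfolding convex_cone_iff
proof (intro conjI ballI allI impI)
  let ?L = "{t + s *\<^sub>R u |t s. t \<in> T}"
  show "0 \<in> ?L"
    using convex_cone_contains_0[OF assms] by (force intro: exI[of _ 0])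
  fix x assume "x \<in> ?L"
  then obtain t s where x: "x = t + s *\<^sub>R u" "t \<in> T" by blast
  show "x + y \<in> ?L" if y: "y \<in> ?L" for y
  proof -
    obtain t' s' where y': "y = t' + s' *\<^sub>R u" "t' \<in> T" using y by blast
    have "x + y = (t + t') + (s + s') *\<^sub>R u"
      by (simp add: x y' algebra_simps)
    then show ?thesis
      using convex_cone_add[OF assms x(2) y'(2)] by blast
  qed
  show "c *\<^sub>R x \<in> ?L" if c: "c \<ge> 0" for c
  proof -
    have "c *\<^sub>R x = c *\<^sub>R t + (c * s) *\<^sub>R u"
      by (simp add: x algebra_simps)
    then show ?thesis
      using convex_cone_scaleR[OF assms c x(2)] by blast
  qed
qed

text \<open>Induction on the dimension: the projection of \<open>T\<close> along \<open>u \<in> T\<close> inherits the hypothesis, so it is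
  finitely generated and hence so is \<open>T\<close> near \<open>u\<close>. Compactness of the unit sphere concludes.\<close>

theorem convex_cone_finitely_generated:
  fixes T :: "'a::euclidean_space set"
  assumes "convex_cone T"
    and "\<And>u. u \<in> T \<Longrightarrow> closed {t + s *\<^sub>R u |t s. t \<in> T}"
  shows "\<exists>G. finite G \<and> T = convex_cone hull G"
  using assms
proof (induction "dim T" arbitrary: T rule: less_induct)
  case less
  note cone = less.prems(1) and closed_sum = less.prems(2)
  have "\<exists>e G. e > 0 \<and> finite G \<and> G \<subseteq> T \<and> T \<inter> ball u e \<subseteq> convex_cone hull G"
    if u: "u \<in> T" "u \<noteq> 0" for u
  proof -
    define P where "P = {t + s *\<^sub>R u |t s. t \<in> T} \<inter> {x. u \<bullet> x = 0}"
    have "subspace {x. u \<bullet> x = 0}"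
      by (rule subspace_hyperplane)
    then have "convex_cone P"
      using convex_cone_plus_line[OF cone, of u] unfolding P_def
      by (auto simp: convex_cone_iff subspace_def)
    moreover have "dim P < dim T"
    proof (rule dim_psubset)
      have "P \<subseteq> span T"
        unfolding P_def using u(1) by (auto intro!: span_add span_scale intro: span_base)
      moreover have "span P \<subseteq> {x. u \<bullet> x = 0}"
        by (rule span_minimal) (auto simp: P_def subspace_hyperplane)
      then have "u \<notin> span P"
        using u(2) by auto
      ultimately show "span P \<subset> span T"
        using u(1) span_base[of u T] span_minimal[of P "span T"] by (metis psubsetI subspace_span)
    qed
    moreover have "closed {t + s *\<^sub>R w |t s. t \<in> P}" if w: "w \<in> P" for w
    proof -
      obtain t0 s0 where w0: "w = t0 + s0 *\<^sub>R u" "t0 \<in> T" and uw: "u \<bullet> w = 0"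
        using w by (auto simp: P_def)
      \<comment> \<open>Since \<open>u\<close> and \<open>t0\<close> lie in \<open>T\<close>, adding
        the line through \<open>u + t0\<close> to \<open>T\<close> amounts to adding the lines
        through \<open>u\<close> and through \<open>t0\<close>. So one vector of \<open>T\<close>
        suffices to describe the sum of \<open>P\<close> and the line through
        \<open>w\<close>.\<close>
      have "{t + s *\<^sub>R w |t s. t \<in> P} = {t + s *\<^sub>R (u + t0) |t s. t \<in> T} \<inter> {x. u \<bullet> x = 0}" (is "?L = ?R")
      proof (intro equalityI subsetI)
        fix x assume "x \<in> ?L"
        then obtain t s r where x: "x = (t + s *\<^sub>R u) + r *\<^sub>R w" "t \<in> T" "u \<bullet> (t + s *\<^sub>R u) = 0"
          by (auto simp: P_def)
        \<comment> \<open>Taking out \<open>m\<close> copies of \<open>u + t0\<close> leaves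
          nonnegative coefficients of both \<open>u\<close> and \<open>t0\<close>.\<close>
        define m where "m = min (s + r * s0) r"
        have "t + ((s + r * s0 - m) *\<^sub>R u + (r - m) *\<^sub>R t0) \<in> T"
          by (intro convex_cone_add[OF cone] convex_cone_scaleR[OF cone] x u w0) (auto simp: m_def)
        moreover have "x = t + ((s + r * s0 - m) *\<^sub>R u + (r - m) *\<^sub>R t0) + m *\<^sub>R (u + t0)"
          by (simp add: x w0 algebra_simps)
        moreover have "u \<bullet> x = 0"
          using x(3) uw unfolding x(1) by (simp add: inner_add_right)
        ultimately show "x \<in> ?R" by blast
      next
        fix x assume "x \<in> ?R"
        then obtain t s where x: "x = t + s *\<^sub>R (u + t0)" "t \<in> T" "u \<bullet> x = 0"
          by auto
        have eq: "x = (t + (s - s * s0) *\<^sub>R u) + s *\<^sub>R w"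
          by (simp add: x(1) w0 algebra_simps)
        have "u \<bullet> (t + (s - s * s0) *\<^sub>R u) = 0"
          using x(3) uw unfolding eq inner_add_right[of u "t + (s - s * s0) *\<^sub>R u"] by simp
        then have "t + (s - s * s0) *\<^sub>R u \<in> P"
          using x(2) by (auto simp: P_def)
        with eq show "x \<in> ?L" by blast
      qed
      moreover have "u + t0 \<in> T"
        using convex_cone_add[OF cone u(1) w0(2)] .
      ultimately show ?thesis
        using closed_sum by (simp add: closed_Int closed_hyperplane)
    qed
    ultimately obtain H where H: "finite H" "P = convex_cone hull H"
      using less.hyps[of P] by blast
    \<comment> \<open>Local generation is stated for a generating set that contains
      \<open>0\<close>.\<close>
    have "P = convex_cone hull (insert 0 H)"
      unfolding H(2) using hull_redundant[of 0 convex_cone H] by (simp add: convex_cone_hull_contains_0)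
    then show ?thesis
      using conic_locally_generated[OF cone u, of "insert 0 H"] H(1) unfolding P_def
      by (metis finite_insert insertI1)
  qed
  then obtain e G where eG: "\<And>u. u \<in> T \<Longrightarrow> u \<noteq> 0 \<Longrightarrow>
      e u > 0 \<and> finite (G u) \<and> G u \<subseteq> T \<and> T \<inter> ball u (e u) \<subseteq> convex_cone hull (G u)"
    by metis
  let ?S = "T \<inter> sphere 0 1"
  \<comment> \<open>For \<open>u = 0\<close> the hypothesis says that \<open>T\<close> itself is
    closed.\<close>
  have "closed T"
    using closed_sum[OF convex_cone_contains_0[OF cone]] by simp
  then have "compact ?S"
    by (simp add: closed_Int_compact)
  moreover have "?S \<subseteq> (\<Union>u\<in>?S. ball u (e u))"
    using eG by fastforce
  ultimately obtain U where U: "U \<subseteq> ?S" "finite U" "?S \<subseteq> (\<Union>u\<in>U. ball u (e u))"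
    by (metis (no_types, lifting) compactE_image open_ball)
  have U': "u \<in> T" "u \<noteq> 0" if "u \<in> U" for u
    using U(1) that by auto
  let ?G = "\<Union>u\<in>U. G u"
  have "finite ?G"
    using U(2) U' eG by blast
  moreover have "convex_cone hull ?G \<subseteq> T"
    using U' eG by (intro hull_minimal cone) blast
  moreover have "T \<subseteq> convex_cone hull ?G"
  proof
    fix x assume x: "x \<in> T"
    show "x \<in> convex_cone hull ?G"
    proof (cases "x = 0")
      case False
      then have "(1 / norm x) *\<^sub>R x \<in> ?S"
        using convex_cone_scaleR[OF cone _ x, of "1 / norm x"] by simp
      then obtain v where v: "v \<in> U" "(1 / norm x) *\<^sub>R x \<in> T \<inter> ball v (e v)"
        using U(3) by blast
      then have "(1 / norm x) *\<^sub>R x \<in> convex_cone hull (G v)"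
        using eG U' by blast
      also have "\<dots> \<subseteq> convex_cone hull ?G"
        using v(1) by (intro hull_mono) blast
      finally show ?thesis
        using convex_cone_hull_mul[of _ ?G "norm x"] False by fastforce
    qed (simp add: convex_cone_hull_contains_0)
  qed
  ultimately show ?case
    by blast
qed

section \<open>The cone of a convex set seen from a point\<close>

lemma convex_cone_cone_at:
  assumes "convex K" "K \<noteq> {}"
  shows "convex_cone {t *\<^sub>R (x - z) |x t. x \<in> K \<and> t \<ge> 0}"
proof -
  have "{t *\<^sub>R (x - z) |x t. x \<in> K \<and> t \<ge> 0} = conic hull ((\<lambda>x. x - z) ` K)"
    unfolding conic_hull_explicit by blast
  moreover have "convex ((\<lambda>x. x - z) ` K)"
    using assms(1) by simp
  ultimately show ?thesis
    using assms(2) unfolding convex_cone_def by (simp add: convex_conic_hull conic_conic_hull conic_hull_eq_empty)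
qed

text \<open>The given half-spaces need not have \<open>z\<close> on their boundary. Arbitrarily
  large multiples of a vector of \<open>T\<close> stay in \<open>T\<close>, so the bounds can be
  tightened to \<open>0\<close>; conversely, \<open>0 \<in> T\<close> shows that \<open>z\<close>
  satisfies each original inequality.\<close>

lemma homogeneous_inequalities:
  fixes T :: "'a::euclidean_space set"
  assumes poly: "polyhedral_in ((+) z ` S) ((+) z ` (T \<inter> S))"
    and cone: "convex_cone T" and S: "subspace S"
  obtains A where "finite A" "T \<inter> S = {x \<in> S. \<forall>a\<in>A. a \<bullet> x \<le> 0}"
proof -
  obtain F where F: "finite F" "(+) z ` (T \<inter> S) = (+) z ` S \<inter> \<Inter>F"
    and half: "\<And>h. h \<in> F \<Longrightarrow> \<exists>a b. a \<noteq> 0 \<and> h = {x. a \<bullet> x \<le> b}"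
    using poly unfolding polyhedral_in_def by metis
  obtain a b where ab: "\<And>h. h \<in> F \<Longrightarrow> h = {x. a h \<bullet> x \<le> b h}"
    using half by metis
  have mem: "x \<in> T \<longleftrightarrow> (\<forall>h\<in>F. a h \<bullet> (z + x) \<le> b h)" if "x \<in> S" for x
  proof -
    have "x \<in> T \<longleftrightarrow> z + x \<in> (+) z ` (T \<inter> S)"
      using that by auto
    also have "\<dots> \<longleftrightarrow> (\<forall>h\<in>F. z + x \<in> h)"
      unfolding F(2) using that by auto
    also have "\<dots> \<longleftrightarrow> (\<forall>h\<in>F. a h \<bullet> (z + x) \<le> b h)"
      using ab by blast
    finally show ?thesis .
  qed
  have "T \<inter> S = {x \<in> S. \<forall>a\<in>a ` F. a \<bullet> x \<le> 0}"
  proof (intro equalityI subsetI)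
    fix x assume x: "x \<in> T \<inter> S"
    have "a h \<bullet> x \<le> 0" if h: "h \<in> F" for h
    proof (rule ccontr)
      assume "\<not> a h \<bullet> x \<le> 0"
      then have pos: "a h \<bullet> x > 0" by simp
      \<comment> \<open>Scaled so that \<open>a h \<bullet> (t *\<^sub>R x)\<close> exceeds
        \<open>b h - a h \<bullet> z\<close>.\<close>
      define t where "t = (\<bar>b h - a h \<bullet> z\<bar> + 1) / (a h \<bullet> x)"
      have "t *\<^sub>R x \<in> T" "t *\<^sub>R x \<in> S"
        using x pos convex_cone_scaleR[OF cone, of t x] subspace_scale[OF S]
        by (auto simp: t_def)
      then have "a h \<bullet> (z + t *\<^sub>R x) \<le> b h"
        using mem h by blast
      moreover have "a h \<bullet> (t *\<^sub>R x) = \<bar>b h - a h \<bullet> z\<bar> + 1"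
        using pos by (simp add: t_def)
      ultimately show False
        by (simp add: inner_add_right)
    qed
    then show "x \<in> {x \<in> S. \<forall>a\<in>a ` F. a \<bullet> x \<le> 0}"
      using x by auto
  next
    fix x assume x: "x \<in> {x \<in> S. \<forall>a\<in>a ` F. a \<bullet> x \<le> 0}"
    have "a h \<bullet> (z + x) \<le> b h" if "h \<in> F" for h
    proof -
      have "a h \<bullet> z \<le> b h"
        using mem[of 0] that convex_cone_contains_0[OF cone] subspace_0[OF S] by auto
      moreover have "a h \<bullet> x \<le> 0"
        using x that by auto
      ultimately show ?thesis
        by (simp add: inner_add_right)
    qed
    then show "x \<in> T \<inter> S"
      using mem x by auto
  qed
  with F(1) that show thesis
    by blast
qed

lemma cone_at_finitely_generated:
  fixes K :: "'a::euclidean_space set"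
  assumes "convex K" and int: "interior K \<noteq> {}" and k: "3 \<le> k" "k \<le> DIM('a)"
    and sections: "\<And>H. affine H \<Longrightarrow> aff_dim H = int k \<Longrightarrow> z \<in> H \<Longrightarrow> H \<inter> interior K \<noteq> {} \<Longrightarrow>
      polyhedral_in H (visual_cone z K \<inter> H)"
  shows "\<exists>G. finite G \<and> {t *\<^sub>R (x - z) |x t. x \<in> K \<and> t \<ge> 0} = convex_cone hull G"
proof -
  define T where "T = {t *\<^sub>R (x - z) |x t. x \<in> K \<and> t \<ge> 0}"
  have cone: "convex_cone T"
    unfolding T_def using assms(1) int interior_subset by (intro convex_cone_cone_at) auto
  have vis: "visual_cone z K = (+) z ` T"
    unfolding visual_cone_def T_def by auto
  obtain c0 where c0: "c0 \<in> interior K"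
    using int by blast
  define c where "c = c0 - z"
  have "(\<lambda>x. x - z) ` K \<subseteq> T"
    unfolding T_def by (force intro: exI[of _ 1])
  then have cT: "c \<in> interior T"
    using c0 interior_mono[of "(\<lambda>x. x - z) ` K" T] interior_translation_subtract[of z K]
    unfolding c_def by blast
  have "closed {t + s *\<^sub>R u |t s. t \<in> T}" if u: "u \<in> T" for u
  proof -
    let ?L = "{t + s *\<^sub>R u |t s. t \<in> T}"
    have "convex ?L"
      using convex_cone_plus_line[OF cone] by (simp add: convex_cone_def)
    have "T \<subseteq> ?L"
      by (force intro: exI[of _ 0])
    then have cL: "c \<in> interior ?L"
      using cT interior_mono by blast
    have "y \<in> ?L" if y: "y \<in> closure ?L" for y
    proof -
      \<comment> \<open>The vector \<open>c\<close> is included for two reasons: the section then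
        meets \<open>interior K\<close>, and \<open>y\<close> can be approached inside the section
        from the interior of \<open>?L\<close>.\<close>
      have "dim {u, y, c} \<le> card {u, y, c}"
        by (intro dim_le_card) (auto intro: span_base)
      also have "\<dots> \<le> 3"
        by (simp add: card_insert_le_m1)
      finally have "dim {u, y, c} \<le> k"
        using k(1) by simp
      then obtain S where S: "subspace S" "{u, y, c} \<subseteq> S" "dim S = k"
        using subspace_superset_of_dim k(2) by blast
      have "polyhedral_in ((+) z ` S) (visual_cone z K \<inter> (+) z ` S)"
      proof (rule sections)
        show "affine ((+) z ` S)"
          using S(1) subspace_imp_affine affine_translation by blast
        show "aff_dim ((+) z ` S) = int k"
          using S(1,3) by (simp add: aff_dim_translation_eq aff_dim_subspace)
        show "z \<in> (+) z ` S"
          using subspace_0[OF S(1)] by force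
        have "c0 = z + c" by (simp add: c_def)
        then show "(+) z ` S \<inter> interior K \<noteq> {}"
          using c0 S(2) by auto
      qed
      then have "polyhedral_in ((+) z ` S) ((+) z ` (T \<inter> S))"
        unfolding vis by (simp add: image_Int)
      then obtain A where A: "finite A" "T \<inter> S = {x \<in> S. \<forall>a\<in>A. a \<bullet> x \<le> 0}"
        using homogeneous_inequalities[OF _ cone S(1)] by blast
      have "a \<bullet> y \<le> 0" if a: "a \<in> A" "a \<bullet> u = 0" for a
      proof -
        \<comment> \<open>Points of the segment from \<open>c\<close> to \<open>y\<close> short of
          \<open>y\<close> lie in \<open>?L\<close> itself. Their \<open>T\<close>-components stay
          in \<open>S\<close>, where the inequalities apply; then \<open>e\<close> tends to
          \<open>0\<close>.\<close>
        have approx: "a \<bullet> (y - e *\<^sub>R (y - c)) \<le> 0" if e: "0 < e" "e \<le> 1" for e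
        proof -
          have "y - e *\<^sub>R (y - c) \<in> ?L"
            using mem_interior_closure_convex_shrink[OF \<open>convex ?L\<close> cL y e] interior_subset by blast
          then obtain t s where ts: "y - e *\<^sub>R (y - c) = t + s *\<^sub>R u" "t \<in> T"
            by blast
          then have "t = y - e *\<^sub>R (y - c) - s *\<^sub>R u"
            by (simp add: algebra_simps)
          also have "\<dots> \<in> S"
            using S(1,2) by (auto intro!: subspace_diff subspace_scale)
          finally have "a \<bullet> t \<le> 0"
            using A(2) a(1) ts(2) by blast
          then show ?thesis
            using a(2) by (simp add: ts(1) inner_add_right)
        qed
        have "((\<lambda>e. a \<bullet> (y - e *\<^sub>R (y - c))) \<longlongrightarrow> a \<bullet> (y - 0 *\<^sub>R (y - c))) (at_right 0)"
          by (intro tendsto_intros)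
        moreover have "eventually (\<lambda>e. a \<bullet> (y - e *\<^sub>R (y - c)) \<le> 0) (at_right 0)"
          unfolding eventually_at_right_field using approx by (intro exI[of _ 1]) auto
        ultimately have "a \<bullet> (y - 0 *\<^sub>R (y - c)) \<le> 0"
          by (rule tendsto_upperbound) simp
        then show ?thesis by simp
      qed
      moreover have "a \<bullet> u \<le> 0" if "a \<in> A" for a
        using A(2) u S(2) that by blast
      ultimately obtain r where r: "\<And>a. a \<in> A \<Longrightarrow> a \<bullet> (y + r *\<^sub>R u) \<le> 0"
        using ray_enters_polyhedral_cone[OF A(1)] by blast
      moreover have "y + r *\<^sub>R u \<in> S"
        using S(1,2) by (auto intro!: subspace_add subspace_scale)
      ultimately have "y + r *\<^sub>R u \<in> T"
        using A(2) by blast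
      moreover have "y = (y + r *\<^sub>R u) + (- r) *\<^sub>R u"
        by simp
      ultimately show ?thesis by blast
    qed
    then show ?thesis
      using closure_subset_eq by blast
  qed
  then show ?thesis
    using convex_cone_finitely_generated[OF cone] unfolding T_def by blast
qed

section \<open>The epigraph of the support function\<close>

lemma convex_cone_support_epigraph: "convex_cone {(y, t). \<forall>x\<in>K. y \<bullet> x \<le> t}"
  unfolding convex_cone_iff
  by (auto simp: zero_prod_def inner_add_left intro: add_mono mult_left_mono)

lemma closed_support_epigraph: "closed {(y, t). \<forall>x\<in>K. y \<bullet> x \<le> t}"
proof -
  have "{(y, t). \<forall>x\<in>K. y \<bullet> x \<le> t} = (\<Inter>x\<in>K. {q. fst q \<bullet> x \<le> snd q})"
    by auto
  moreover have "closed {q. fst q \<bullet> x \<le> snd q}" for x :: 'a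
    by (intro closed_Collect_le continuous_intros)
  ultimately show ?thesis
    by auto
qed

text \<open>A half-space strictly separating \<open>p\<close> from \<open>K\<close> would be given
  by a pair in the epigraph that violates \<open>dom\<close>.\<close>

lemma mem_by_support_epigraph:
  fixes K :: "'a::euclidean_space set"
  assumes "compact K" "convex K"
    and dom: "\<And>y t. (\<forall>x\<in>K. y \<bullet> x \<le> t) \<Longrightarrow> y \<bullet> p \<le> t"
  shows "p \<in> K"
proof (rule ccontr)
  assume "p \<notin> K"
  then obtain y b where yb: "y \<bullet> p < b" "\<forall>x\<in>K. y \<bullet> x > b"
    using separating_hyperplane_closed_point[OF assms(2) compact_imp_closed[OF assms(1)]] by blast
  then have "\<forall>x\<in>K. - y \<bullet> x \<le> - b"
    by (auto intro: less_imp_le)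
  from dom[OF this] yb(1) show False
    by simp
qed

text \<open>A functional supporting \<open>L\<close> at \<open>(v, r)\<close> can be scaled to \<open>(y, t) \<mapsto> t - p \<bullet> y\<close>,
  because \<open>L\<close> contains \<open>(0, 1)\<close> and lies over every \<open>y\<close>.\<close>

lemma support_epigraph_boundary_point:
  fixes K :: "'a::euclidean_space set"
  assumes K: "compact K" "convex K"
    and L: "L = {q + m *\<^sub>R (a, s) |q m. q \<in> {(y, t). \<forall>x\<in>K. y \<bullet> x \<le> t}}"
    and w: "(v, r) \<in> closure L" "(v, r) \<notin> L"
  obtains p where "p \<in> K" "p \<bullet> a = s" "p \<bullet> v = r"
proof -
  let ?E = "{(y, t). \<forall>x\<in>K. y \<bullet> x \<le> t}"
  have cone: "convex_cone L"
    unfolding L by (rule convex_cone_plus_line[OF convex_cone_support_epigraph])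
  have EL: "?E \<subseteq> L"
    unfolding L by (force intro: exI[of _ 0])
  have line: "m *\<^sub>R (a, s) \<in> L" for m
    unfolding L by (force intro: exI[of _ 0])
  have "(v, r) \<notin> rel_interior L"
    using w(2) rel_interior_subset by blast
  then obtain n where n: "n \<noteq> 0" "\<And>q. q \<in> closure L \<Longrightarrow> n \<bullet> (v, r) \<le> n \<bullet> q"
    using supporting_hyperplane_relative_frontier[of L "(v, r)"] w(1) cone
    unfolding convex_cone_def by metis
  \<comment> \<open>A linear functional bounded below on a cone is nonnegative there: otherwise a
    large multiple of \<open>q\<close> would fall below the value at \<open>(v, r)\<close>.\<close>
  have pos: "n \<bullet> q \<ge> 0" if q: "q \<in> L" for q
  proof (rule ccontr)
    assume "\<not> n \<bullet> q \<ge> 0"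
    then have neg: "n \<bullet> q < 0" by simp
    define m where "m = (\<bar>n \<bullet> (v, r)\<bar> + 1) / - (n \<bullet> q)"
    have "m \<ge> 0"
      using neg unfolding m_def by (intro divide_nonneg_pos) auto
    then have "m *\<^sub>R q \<in> closure L"
      using convex_cone_scaleR[OF cone _ q] closure_subset by blast
    from n(2)[OF this] have "n \<bullet> (v, r) \<le> - (\<bar>n \<bullet> (v, r)\<bar> + 1)"
      using neg by (simp add: m_def)
    then show False by linarith
  qed
  have "closure L \<subseteq> {q. n \<bullet> q \<ge> 0}"
    using pos by (intro closure_minimal closed_halfspace_ge) auto
  then have "n \<bullet> (v, r) \<ge> 0"
    using w(1) by blast
  moreover have "0 \<in> closure L"
    using convex_cone_contains_0[OF cone] closure_subset by blast
  from n(2)[OF this] have "n \<bullet> (v, r) \<le> 0"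
    by simp
  ultimately have nv: "n \<bullet> (v, r) = 0"
    by simp
  have na: "n \<bullet> (a, s) = 0"
    using pos[OF line[of 1]] pos[OF line[of "- 1"]] unfolding inner_scaleR_right by simp
  obtain n1 n2 where n12: "n = (n1, n2)" by force
  have "(0, 1) \<in> L"
    using EL by auto
  from pos[OF this] have "n2 \<ge> 0"
    by (simp add: n12)
  moreover have "n2 \<noteq> 0"
  proof
    assume "n2 = 0"
    \<comment> \<open>Boundedness of \<open>K\<close> gives a point of the epigraph above
      \<open>- n1\<close>. If \<open>n2 = 0\<close>, nonnegativity of \<open>n\<close> at that point
      forces \<open>n1 = 0\<close>.\<close>
    obtain b where b: "\<And>x. x \<in> K \<Longrightarrow> norm x \<le> b"
      using compact_imp_bounded[OF K(1)] bounded_iff by blast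
    have "- n1 \<bullet> x \<le> norm n1 * b" if "x \<in> K" for x
    proof -
      have "- n1 \<bullet> x \<le> norm n1 * norm x"
        using norm_cauchy_schwarz[of "- n1" x] by simp
      also have "\<dots> \<le> norm n1 * b"
        using b[OF that] by (simp add: mult_left_mono)
      finally show ?thesis .
    qed
    then have "(- n1, norm n1 * b) \<in> L"
      using EL by auto
    from pos[OF this] have "n1 \<bullet> n1 \<le> 0"
      using \<open>n2 = 0\<close> by (simp add: n12)
    then have "n1 = 0"
      by (metis inner_gt_zero_iff not_le)
    with \<open>n2 = 0\<close> n(1) n12 show False by (simp add: zero_prod_def)
  qed
  ultimately have n2: "n2 > 0" by simp
  define p where "p = (- 1 / n2) *\<^sub>R n1"
  have p: "p \<bullet> y = t - (n \<bullet> (y, t)) / n2" for y t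
    using n2 by (simp add: p_def n12 field_simps)
  show thesis
  proof
    show "p \<bullet> a = s" "p \<bullet> v = r"
      using p[of a s] p[of v r] unfolding na nv by simp_all
    show "p \<in> K"
    proof (rule mem_by_support_epigraph[OF K])
      fix y t assume "\<forall>x\<in>K. y \<bullet> x \<le> t"
      then have "n \<bullet> (y, t) \<ge> 0"
        using EL by (intro pos) auto
      then show "y \<bullet> p \<le> t"
        using p[of y t] n2 by (simp add: inner_commute)
    qed
  qed
qed

text \<open>The assumption \<open>gen\<close> is the form in which supporting lines enter:
  \<open>z\<close> has the same inner products with \<open>a\<close> and \<open>v\<close> as
  \<open>p\<close>. The vector \<open>v\<close> is arbitrary because it comes from the point at
  which closedness is tested.\<close>

lemma polytope_if_cones_finitely_generated:
  fixes K :: "'a::euclidean_space set"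
  assumes K: "compact K" "convex K"
    and gen: "\<And>a v p. a \<noteq> 0 \<Longrightarrow> p \<in> K \<Longrightarrow> \<forall>x\<in>K. a \<bullet> x \<le> a \<bullet> p \<Longrightarrow>
      \<exists>z G. finite G \<and> a \<bullet> z = a \<bullet> p \<and> v \<bullet> z = v \<bullet> p \<and>
        {t *\<^sub>R (x - z) |x t. x \<in> K \<and> t \<ge> 0} = convex_cone hull G"
  shows "polytope K"
proof -
  define E where "E = {(y, t). \<forall>x\<in>K. y \<bullet> x \<le> t}"
  have cone: "convex_cone E"
    unfolding E_def by (rule convex_cone_support_epigraph)
  have "closed {q + m *\<^sub>R u |q m. q \<in> E}" if u: "u \<in> E" for u
  proof -
    obtain a s where as: "u = (a, s)" by force
    define L where "L = {q + m *\<^sub>R u |q m. q \<in> E}"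
    have "(v, r) \<in> L" if w: "(v, r) \<in> closure L" for v r
    proof (rule ccontr)
      assume notin: "(v, r) \<notin> L"
      obtain p where p: "p \<in> K" "p \<bullet> a = s" "p \<bullet> v = r"
        using support_epigraph_boundary_point[OF K _ w notin] by (auto simp: L_def E_def as)
      have "a \<noteq> 0"
      proof
        assume "a = 0"
        then have "L = E"
          using p(2) by (auto simp: L_def as simp flip: zero_prod_def)
        moreover have "closed E"
          unfolding E_def by (rule closed_support_epigraph)
        ultimately show False
          using w notin by simp
      qed
      have sup: "\<forall>x\<in>K. a \<bullet> x \<le> a \<bullet> p"
        using u p(2) by (auto simp: as E_def inner_commute)
      obtain z G where G: "finite G" "a \<bullet> z = a \<bullet> p" "v \<bullet> z = v \<bullet> p"
        and hull: "{t *\<^sub>R (x - z) |x t. x \<in> K \<and> t \<ge> 0} = convex_cone hull G"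
        using gen[OF \<open>a \<noteq> 0\<close> p(1) sup, of v] by (elim exE conjE) (rule that)
      have gx: "\<exists>x t. g = t *\<^sub>R (x - z) \<and> x \<in> K \<and> t \<ge> 0" if "g \<in> G" for g
        using hull hull_inc[OF that, of convex_cone] by blast
      have "g \<bullet> a \<le> 0" if "g \<in> G" for g
      proof -
        obtain x t where x: "g = t *\<^sub>R (x - z)" "x \<in> K" "t \<ge> 0"
          using gx[OF \<open>g \<in> G\<close>] by blast
        have "(x - z) \<bullet> a \<le> 0"
          using sup x(2) G(2) by (simp add: inner_diff_right inner_commute[of _ a])
        then show ?thesis
          by (simp add: x mult_nonneg_nonpos)
      qed
      moreover have "g \<bullet> v \<le> 0" if g: "g \<in> G" "g \<bullet> a = 0" for g
      proof -
        obtain x t where x: "g = t *\<^sub>R (x - z)" "x \<in> K" "t \<ge> 0"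
          using gx[OF g(1)] by blast
        show ?thesis
        proof (cases "t = 0")
          case False
          then have xa: "a \<bullet> x = s"
            using g(2) x(1) G(2) p(2) by (simp add: inner_diff_left inner_diff_right inner_commute)
          \<comment> \<open>As \<open>a \<bullet> x = s\<close>, the functional
            \<open>(x, - 1)\<close> vanishes on \<open>u\<close>, so its sign on \<open>E\<close>
            carries over to \<open>L\<close> and to its closure. At \<open>(v, r)\<close> this reads
            \<open>x \<bullet> v \<le> r\<close>, and \<open>r\<close> is also
            \<open>z \<bullet> v\<close>.\<close>
          have "L \<subseteq> {q. (x, - 1) \<bullet> q \<le> 0}"
            using x(2) xa by (auto simp: L_def E_def as inner_add_right inner_commute algebra_simps)
          then have "closure L \<subseteq> {q. (x, - 1) \<bullet> q \<le> 0}"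
            by (intro closure_minimal closed_halfspace_le)
          then have "(x, - 1) \<bullet> (v, r) \<le> 0"
            using w by blast
          then have "(x - z) \<bullet> v \<le> 0"
            using G(3) p(3) by (simp add: inner_diff_right inner_commute[of _ v] inner_commute[of x v])
          then show ?thesis
            using x(3) by (simp add: x(1) mult_nonneg_nonpos)
        qed (simp add: x)
      qed
      \<comment> \<open>The generators now act as the constraints: \<open>v + c *\<^sub>R a\<close>
        enters the polar of the cone at \<open>z\<close>, so it is bounded on \<open>K\<close> by
        its value at \<open>z\<close>.\<close>
      ultimately obtain c where c: "\<And>g. g \<in> G \<Longrightarrow> g \<bullet> (v + c *\<^sub>R a) \<le> 0"
        using ray_enters_polyhedral_cone[OF G(1)] by blast
      have half: "convex_cone hull G \<subseteq> {x. (v + c *\<^sub>R a) \<bullet> x \<le> 0}"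
        using c by (intro hull_minimal convex_cone_halfspace_le) (auto simp: inner_commute)
      have "(v + c *\<^sub>R a) \<bullet> x \<le> r + c * s" if "x \<in> K" for x
      proof -
        have "x - z \<in> convex_cone hull G"
          unfolding hull[symmetric] using that by (force intro: exI[of _ 1])
        then have "(v + c *\<^sub>R a) \<bullet> (x - z) \<le> 0"
          using half by blast
        moreover have "(v + c *\<^sub>R a) \<bullet> z = r + c * s"
          using G(2,3) p(2,3) by (simp add: inner_add_left inner_commute[of p])
        ultimately show ?thesis
          by (simp add: inner_diff_right)
      qed
      then have "(v + c *\<^sub>R a, r + c * s) \<in> E"
        by (simp add: E_def)
      moreover have "(v, r) = (v + c *\<^sub>R a, r + c * s) + (- c) *\<^sub>R u"
        by (simp add: as)
      ultimately have "(v, r) \<in> L"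
        unfolding L_def by blast
      with notin show False ..
    qed
    then have "closure L \<subseteq> L"
      by force
    then show ?thesis
      by (simp add: L_def closure_subset_eq)
  qed
  then obtain G where G: "finite G" "E = convex_cone hull G"
    using convex_cone_finitely_generated[OF cone] by blast
  have "K = (\<Inter>(y, t)\<in>G. {x. y \<bullet> x \<le> t})"
  proof (intro equalityI subsetI)
    fix x assume "x \<in> K"
    moreover have "G \<subseteq> E"
      by (simp add: G(2) hull_subset)
    ultimately show "x \<in> (\<Inter>(y, t)\<in>G. {x. y \<bullet> x \<le> t})"
      by (auto simp: E_def)
  next
    fix p assume p: "p \<in> (\<Inter>(y, t)\<in>G. {x. y \<bullet> x \<le> t})"
    \<comment> \<open>The inequalities at the generators propagate to \<open>E\<close>, so
      \<open>p\<close> satisfies every linear inequality valid on \<open>K\<close>.\<close>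
    have "E \<subseteq> {q. (p, - 1) \<bullet> q \<le> 0}"
      unfolding G(2)
      by (intro hull_minimal convex_cone_halfspace_le) (use p in \<open>auto simp: inner_commute\<close>)
    then have dom: "(p, - 1) \<bullet> (y, t) \<le> 0" if "\<forall>x\<in>K. y \<bullet> x \<le> t" for y t
      using that unfolding E_def by blast
    show "p \<in> K"
    proof (rule mem_by_support_epigraph[OF K])
      fix y t assume "\<forall>x\<in>K. y \<bullet> x \<le> t"
      from dom[OF this] show "y \<bullet> p \<le> t"
        by (simp add: inner_commute)
    qed
  qed
  moreover have "polyhedron (\<Inter>(y, t)\<in>G. {x. y \<bullet> x \<le> t})"
    using G(1) by (intro polyhedron_Inter) (auto simp: polyhedron_halfspace_le)
  ultimately have "polyhedron K"
    by simp
  then show ?thesis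
    using compact_imp_bounded[OF K(1)] by (simp add: polytope_eq_bounded_polyhedron)
qed

section \<open>Supporting lines orthogonal to two given vectors\<close>

theorem theorem2:
  fixes K :: "'a::euclidean_space set" and z :: "'b \<Rightarrow> 'a" and B :: "'b set" and k :: nat
  assumes "DIM('a) \<ge> 3"
    and "convex_body K"
    and "\<forall>\<beta>\<in>B. z \<beta> \<notin> K"
    and "\<forall>l. supporting_line K l \<longrightarrow> (\<exists>\<beta>\<in>B. z \<beta> \<in> l)"
    and "3 \<le> k" and "k \<le> DIM('a)"
    and "\<forall>\<beta>\<in>B. \<forall>H. affine H \<and> aff_dim H = int k \<and> z \<beta> \<in> H \<and> H \<inter> interior K \<noteq> {}
            \<longrightarrow> polyhedral_in H (visual_cone (z \<beta>) K \<inter> H)"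
  shows "polytope K"
proof -
  have K: "compact K" "convex K" "interior K \<noteq> {}"
    using assms(2) by (auto simp: convex_body_def)
  show ?thesis
  proof (rule polytope_if_cones_finitely_generated[OF K(1,2)])
    fix a v p :: 'a
    assume a: "a \<noteq> 0" and p: "p \<in> K" and sup: "\<forall>x\<in>K. a \<bullet> x \<le> a \<bullet> p"
    have "dim {a, v} \<le> card {a, v}"
      by (intro dim_le_card) (auto intro: span_base)
    also have "\<dots> \<le> 2"
      by (simp add: card_insert_le_m1)
    \<comment> \<open>Dimension at least three leaves a direction \<open>w\<close> orthogonal to
      both vectors.\<close>
    finally have "dim {a, v} < DIM('a)"
      using assms(1) by simp
    then obtain w where w: "w \<noteq> 0" "span {a, v} \<subseteq> {x. w \<bullet> x = 0}"
      using lowdim_subset_hyperplane by blast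
    then have perp: "a \<bullet> w = 0" "v \<bullet> w = 0"
      using span_base[of _ "{a, v}"] by (auto simp: inner_commute subset_iff)
    define l where "l = (+) p ` span {w}"
    have l_iff: "x \<in> l \<longleftrightarrow> (\<exists>c. x = p + c *\<^sub>R w)" for x
      by (auto simp: l_def span_singleton)
    have "is_line l"
      unfolding is_line_def l_def
      using w(1) by (simp add: affine_translation[symmetric] subspace_imp_affine aff_dim_translation_eq aff_dim_subspace)
    moreover have "l \<inter> K \<noteq> {}"
      using p l_iff[of p] by (metis disjoint_iff add.right_neutral scaleR_zero_left)
    moreover have "l \<inter> K \<subseteq> frontier K"
    proof
      \<comment> \<open>On \<open>l\<close> the functional \<open>a\<close> is constantly equal to
        its maximum over \<open>K\<close>, which no interior point of \<open>K\<close>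
        attains.\<close>
      fix x assume x: "x \<in> l \<inter> K"
      then have ax: "a \<bullet> x = a \<bullet> p"
        using perp by (auto simp: l_iff inner_add_right)
      have "x \<notin> interior K"
      proof
        assume "x \<in> interior K"
        then have "x \<in> interior {y. a \<bullet> y \<le> a \<bullet> p}"
          using interior_mono[of K "{y. a \<bullet> y \<le> a \<bullet> p}"] sup by blast
        then show False
          using a ax by simp
      qed
      then show "x \<in> frontier K"
        using x closure_subset by (auto simp: frontier_def)
    qed
    ultimately have "supporting_line K l"
      by (simp add: supporting_line_def)
    then obtain \<beta> where \<beta>: "\<beta> \<in> B" "z \<beta> \<in> l"
      using assms(4) by blast
    obtain G where "finite G" "{t *\<^sub>R (x - z \<beta>) |x t. x \<in> K \<and> t \<ge> 0} = convex_cone hull G"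
      using cone_at_finitely_generated[OF K(2,3) assms(5,6), of "z \<beta>"] assms(7) \<beta>(1) by blast
    moreover have "a \<bullet> z \<beta> = a \<bullet> p" "v \<bullet> z \<beta> = v \<bullet> p"
      using \<beta>(2) perp by (auto simp: l_iff inner_add_right)
    ultimately show "\<exists>z G. finite G \<and> a \<bullet> z = a \<bullet> p \<and> v \<bullet> z = v \<bullet> p \<and>
        {t *\<^sub>R (x - z) |x t. x \<in> K \<and> t \<ge> 0} = convex_cone hull G"
      by blast
  qed
qed

end
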